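(* Let $m,n\ge1$, $0\le r_1\le m-1$, $0\le r_2\le n-1$, and let $\Sigma=P_m^{(r_1)}\times P_n^{(r_2)}$ be a Cartesian product of signed paths. Then $\Sigma$ is balanced. Its adjacency matrix is $A(P_m^{(r_1)})\otimes I_n+I_m\otimes A(P_n^{(r_2)})$ and its Laplacian matrix is $$4I_{mn}-\big(A(P_m^{(r_1)})+J_{m;11}+J_{m;mm}\big)\otimes I_n-I_m\otimes\big(A(P_n^{(r_2)})+J_{n;11}+J_{n;nn}\big).$$ The eigenvalues are $$\lambda_{ij}=2\Big(\cos\frac{\pi i}{m+1}+\cos\frac{\pi j}{n+1}\Big),\qquad 1\le i\le m,\ 1\le j\le n,$$ and the energy is $$E(\Sigma)=2\sum_{i=1}^m\sum_{j=1}^n\Big|\cos\frac{\pi i}{m+1}+\cos\frac{\pi j}{n+1}\Big|.$$ The Laplacian eigenvalues are $$\lambda_{ij}^L=2\Big(2+\cos\frac{\pi i}{m}+\cos\frac{\pi j}{n}\Big),\qquad 1\le i\le m,\ 1\le j\le n.$$ Exactly one Laplacian eigenvalue is zero (namely $\lambda_{mn}^L$); the others are positive. The Laplacian energy is $$E_L(\Sigma)=2\sum_{i=1}^m\sum_{j=1}^n\Big|\cos\frac{\pi i}{m}+\cos\frac{\pi j}{n}+\frac1m+\frac1n\Big|.$$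
   Context: A signed graph $\Sigma=(G,\sigma)$ is a finite simple graph $G=(V,E)$ with a function $\sigma:E\to\{+1,-1\}$; it is balanced if the product of edge signs around every cycle is $+1$. The adjacency matrix $A(\Sigma)$ has $(u,v)$ entry $\sigma(uv)$ if $u,v$ are adjacent and $0$ otherwise; its eigenvalues are the eigenvalues of $\Sigma$, and the energy $E(\Sigma)$ is the sum of their absolute values. The Laplacian matrix is $L(\Sigma)=D(\Sigma)-A(\Sigma)$, $D(\Sigma)$ being the diagonal matrix of vertex degrees; its eigenvalues are the Laplacian eigenvalues. The Laplacian energy is $E_L(\Sigma)=\sum_j|\lambda_j(L(\Sigma))-\bar d(\Sigma)|$ with $\bar d(\Sigma)=2|E|/|V|$. The Cartesian product of signed graphs $\Sigma_i=(V_i,E_i,\sigma_i)$, $i=1,2$, is the signed graph on $V_1\times V_2$ in which $(u,v)(u',v')$ is an edge iff $v=v'$ and $uu'\in E_1$ (sign $\sigma_1(uu')$), or $u=u'$ and $vv'\in E_2$ (sign $\sigma_2(vv')$). $P_n^{(r)}$ denotes any signed path with $n$ vertices $v_1,\ldots,v_n$ (in order along the path) having exactly $r$ negative edges. $J_{n;ij}$ is the $n\times n$ matrix whose only nonzero entry is $1$ in position $(i,j)$. $\otimes$ is the Kronecker product, with vertices of the product ordered lexicographically. *)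

theory Defs
  imports Complex_Main "HOL-Library.Multiset"
    "HOL-Computational_Algebra.Polynomial" "Jordan_Normal_Form.Char_Poly"
begin

(* An edge is a two-element set of vertices.  Values of sign outside the edge set are irrelevant. *)
record 'a sgraph =
  verts :: "'a set"
  edges :: "'a set set"
  sign :: "'a set \<Rightarrow> real"

definition signed_graph :: "'a sgraph \<Rightarrow> bool" where
  "signed_graph S \<longleftrightarrow>
     finite (verts S) \<and>
     edges S \<subseteq> {{u, v} | u v. u \<in> verts S \<and> v \<in> verts S \<and> u \<noteq> v} \<and>
     sign S ` edges S \<subseteq> {1, -1}"

definition is_cycle :: "'a sgraph \<Rightarrow> 'a list \<Rightarrow> bool" where
  "is_cycle S c \<longleftrightarrow> 3 \<le> length c \<and> distinct c \<and>
     (\<forall>i<length c. {c ! i, c ! (Suc i mod length c)} \<in> edges S)"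

definition balanced :: "'a sgraph \<Rightarrow> bool" where
  "balanced S \<longleftrightarrow>
     (\<forall>c. is_cycle S c \<longrightarrow> (\<Prod>i<length c. sign S {c ! i, c ! (Suc i mod length c)}) = 1)"

definition vertex_degree :: "'a sgraph \<Rightarrow> 'a \<Rightarrow> nat" where
  "vertex_degree S v = card {e \<in> edges S. v \<in> e}"

definition mean_degree :: "'a sgraph \<Rightarrow> real" where
  "mean_degree S = 2 * real (card (edges S)) / real (card (verts S))"

definition is_enum :: "'a set \<Rightarrow> 'a list \<Rightarrow> bool" where
  "is_enum V xs \<longleftrightarrow> distinct xs \<and> set xs = V"

(* The matrices of a signed graph are taken with respect to an enumeration xs of its vertices. *)
definition adjacency_mat :: "'a sgraph \<Rightarrow> 'a list \<Rightarrow> real mat" where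
  "adjacency_mat S xs = mat (length xs) (length xs)
     (\<lambda>(i, j). if {xs ! i, xs ! j} \<in> edges S then sign S {xs ! i, xs ! j} else 0)"

definition degree_mat :: "'a sgraph \<Rightarrow> 'a list \<Rightarrow> real mat" where
  "degree_mat S xs = mat (length xs) (length xs)
     (\<lambda>(i, j). if i = j then real (vertex_degree S (xs ! i)) else 0)"

definition laplacian_mat :: "'a sgraph \<Rightarrow> 'a list \<Rightarrow> real mat" where
  "laplacian_mat S xs = degree_mat S xs - adjacency_mat S xs"

(* Eigenvalues with algebraic multiplicity.  The matrices used here are real symmetric, so the real
   roots of the characteristic polynomial are all of its roots. *)
definition mat_eigenvalues :: "real mat \<Rightarrow> real multiset" where
  "mat_eigenvalues A = proots (char_poly A)"

(* Another enumeration conjugates the matrices by a permutation matrix, so that the spectra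
   below do not depend on the enumeration chosen. *)
definition some_enum :: "'a set \<Rightarrow> 'a list" where
  "some_enum V = (SOME xs. is_enum V xs)"

definition eigenvalues :: "'a sgraph \<Rightarrow> real multiset" where
  "eigenvalues S = mat_eigenvalues (adjacency_mat S (some_enum (verts S)))"

definition laplacian_eigenvalues :: "'a sgraph \<Rightarrow> real multiset" where
  "laplacian_eigenvalues S = mat_eigenvalues (laplacian_mat S (some_enum (verts S)))"

definition energy :: "'a sgraph \<Rightarrow> real" where
  "energy S = (\<Sum>x\<in>#eigenvalues S. \<bar>x\<bar>)"

definition laplacian_energy :: "'a sgraph \<Rightarrow> real" where
  "laplacian_energy S = (\<Sum>x\<in>#laplacian_eigenvalues S. \<bar>x - mean_degree S\<bar>)"

(* For an edge e = {(u,v), (u',v')} of the product, snd ` e is a singleton iff v = v', and then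
   fst ` e is the edge {u,u'} of the first factor; otherwise snd ` e is the edge {v,v'}. *)
definition cart_prod :: "'a sgraph \<Rightarrow> 'b sgraph \<Rightarrow> ('a \<times> 'b) sgraph" where
  "cart_prod S T =
     \<lparr> verts = verts S \<times> verts T,
       edges = {{(u, v), (u', v')} | u v u' v'.
                  (v = v' \<and> v \<in> verts T \<and> {u, u'} \<in> edges S) \<or>
                  (u = u' \<and> u \<in> verts S \<and> {v, v'} \<in> edges T)},
       sign = (\<lambda>e. if card (snd ` e) = 1 then sign S (fst ` e) else sign T (snd ` e)) \<rparr>"

lemma sign_cart_prod_fst: "sign (cart_prod S T) {(u, v), (u', v)} = sign S {u, u'}"
  by (simp add: cart_prod_def)

lemma sign_cart_prod_snd:
  "v \<noteq> v' \<Longrightarrow> sign (cart_prod S T) {(u, v), (u, v')} = sign T {v, v'}"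
  by (simp add: cart_prod_def)

lemma signed_graph_edge:
  assumes "signed_graph S" and "{u, v} \<in> edges S"
  shows "u \<in> verts S" "v \<in> verts S" "u \<noteq> v" "sign S {u, v} \<in> {1, -1}"
proof -
  obtain a b where "{u, v} = {a, b}" "a \<in> verts S" "b \<in> verts S" "a \<noteq> b"
    using assms unfolding signed_graph_def by blast
  then show "u \<in> verts S" "v \<in> verts S" "u \<noteq> v"
    by (auto simp: doubleton_eq_iff)
  show "sign S {u, v} \<in> {1, -1}"
    using assms unfolding signed_graph_def by blast
qed

lemma signed_graph_cart_prod:
  assumes S: "signed_graph S" and T: "signed_graph T"
  shows "signed_graph (cart_prod S T)"
proof -
  have V: "verts (cart_prod S T) = verts S \<times> verts T"
    by (simp add: cart_prod_def)
  have edge: "e \<in> {{p, q} | p q. p \<in> verts (cart_prod S T) \<and> q \<in> verts (cart_prod S T) \<and> p \<noteq> q}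
      \<and> sign (cart_prod S T) e \<in> {1, -1}" if e: "e \<in> edges (cart_prod S T)" for e
  proof -
    from e obtain u v u' v' where e_eq: "e = {(u, v), (u', v')}"
      and "(v = v' \<and> v \<in> verts T \<and> {u, u'} \<in> edges S) \<or>
           (u = u' \<and> u \<in> verts S \<and> {v, v'} \<in> edges T)"
      unfolding cart_prod_def sgraph.simps mem_Collect_eq by blast
    then have "(u, v) \<in> verts S \<times> verts T \<and> (u', v') \<in> verts S \<times> verts T \<and> (u, v) \<noteq> (u', v') \<and>
        sign (cart_prod S T) e \<in> {1, -1}"
    proof (elim disjE conjE)
      assume "v = v'" "v \<in> verts T" "{u, u'} \<in> edges S"
      then show ?thesis
        using signed_graph_edge[OF S, of u u'] e_eq by (simp add: sign_cart_prod_fst)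
    next
      assume "u = u'" "u \<in> verts S" "{v, v'} \<in> edges T"
      then show ?thesis
        using signed_graph_edge[OF T, of v v'] e_eq by (simp add: sign_cart_prod_snd)
    qed
    then show ?thesis
      unfolding V using e_eq by blast
  qed
  have "finite (verts (cart_prod S T))"
    using S T unfolding V signed_graph_def by simp
  then show ?thesis
    unfolding signed_graph_def using edge by blast
qed

(* S is a signed path with r negative edges whose n vertices, in order along the path, are vs. *)
definition signed_path :: "nat \<Rightarrow> nat \<Rightarrow> 'a list \<Rightarrow> 'a sgraph \<Rightarrow> bool" where
  "signed_path n r vs S \<longleftrightarrow>
     signed_graph S \<and> is_enum (verts S) vs \<and> length vs = n \<and>
     edges S = {{vs ! i, vs ! Suc i} | i. Suc i < n} \<and>
     card {e \<in> edges S. sign S e = -1} = r"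

(* Positions a, b are counted from 1, whereas matrix indices start at 0. *)
definition J_mat :: "nat \<Rightarrow> nat \<Rightarrow> nat \<Rightarrow> real mat" where
  "J_mat n a b = mat n n (\<lambda>(i, j). if Suc i = a \<and> Suc j = b then 1 else 0)"

definition kronecker :: "real mat \<Rightarrow> real mat \<Rightarrow> real mat" where
  "kronecker A B = mat (dim_row A * dim_row B) (dim_col A * dim_col B)
     (\<lambda>(i, j). A $$ (i div dim_row B, j div dim_col B) * B $$ (i mod dim_row B, j mod dim_col B))"

end

theory Submission
  imports Defs
begin

text \<open>
  A matrix with as many pairwise orthogonal nonzero eigenvectors as its size has exactly the
  corresponding eigenvalues, with multiplicity, and a Kronecker sum inherits the products of the
  eigenvectors of its two summands. So everything reduces to one signed path.  A path is balanced, and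
  switching by the sign products from its first vertex turns it into the unsigned path.
  There the vectors \<open>sin (\<theta> (i + 1))\<close>, \<open>\<theta> = \<pi> k / (n + 1)\<close>, diagonalise the adjacency matrix because they
  vanish just beyond both ends, and \<open>cos (\<theta> (i + 1 / 2))\<close>, \<open>\<theta> = \<pi> - \<pi> k / n\<close>, the Laplacian because they
  are symmetric about the midpoints just beyond both ends.  The eigenvalues being distinct, these
  vectors are orthogonal.
\<close>

section \<open>Orthogonal eigenbases\<close>

text \<open>Functions on the vertex set replace vectors, so no enumeration enters. The final
  equivalence says two things at once: for \<open>k \<noteq> l\<close> it is orthogonality, for
  \<open>k = l\<close> it makes the squared norm, hence the vector, nonzero.\<close>

definition orthogonal_eigenbasis ::
  "'a set \<Rightarrow> ('a \<Rightarrow> 'a \<Rightarrow> real) \<Rightarrow> 'k set \<Rightarrow> ('k \<Rightarrow> 'a \<Rightarrow> real) \<Rightarrow> ('k \<Rightarrow> real) \<Rightarrow> bool" where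
  "orthogonal_eigenbasis V M K f \<mu> \<longleftrightarrow>
     finite V \<and> finite K \<and> card K = card V \<and>
     (\<forall>k\<in>K. \<forall>u\<in>V. (\<Sum>v\<in>V. M u v * f k v) = \<mu> k * f k u) \<and>
     (\<forall>k\<in>K. \<forall>l\<in>K. (\<Sum>v\<in>V. f k v * f l v) = 0 \<longleftrightarrow> k \<noteq> l)"

lemma proots_prod_linear_factors:
  "proots (\<Prod>a\<leftarrow>as. [:- a, 1:]) = mset (as :: 'a::idom list)"
  by (induction as) (simp_all add: proots_mult image_iff del: mult_pCons_left)

lemma some_enum_is_enum:
  assumes "finite V"
  shows "is_enum V (some_enum V)"
  unfolding some_enum_def
  by (rule someI_ex) (use finite_distinct_list[OF assms] in \<open>auto simp: is_enum_def\<close>)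

lemma sum_is_enum:
  assumes "is_enum V xs"
  shows "sum h V = (\<Sum>i<length xs. h (xs ! i))"
  using assms sum.reindex_bij_betw[OF bij_betw_nth[of xs "{..<length xs}" V], of h]
  by (simp add: is_enum_def)

text \<open>With the eigenvectors as columns of \<open>W\<close>, orthogonality makes the transpose,
  its rows divided by the squared norms, an inverse \<open>W'\<close>. So the matrix is similar to
  the diagonal matrix \<open>D\<close>, and its characteristic polynomial splits into the factors
  given by \<open>\<mu>\<close>.\<close>

lemma orthogonal_eigenbasis_mat_eigenvalues:
  assumes basis: "orthogonal_eigenbasis V M K f \<mu>" and xs: "is_enum V xs"
  shows "mat_eigenvalues (mat (length xs) (length xs) (\<lambda>(i, j). M (xs ! i) (xs ! j))) =
    image_mset \<mu> (mset_set K)"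
proof -
  define ks where "ks = some_enum K"
  define N where "N = length xs"
  have K: "finite K" "card K = card V"
    and eigen: "\<And>k u. k \<in> K \<Longrightarrow> u \<in> V \<Longrightarrow> (\<Sum>v\<in>V. M u v * f k v) = \<mu> k * f k u"
    and orth: "\<And>k l. k \<in> K \<Longrightarrow> l \<in> K \<Longrightarrow> (\<Sum>v\<in>V. f k v * f l v) = 0 \<longleftrightarrow> k \<noteq> l"
    using basis unfolding orthogonal_eigenbasis_def by auto
  have ks: "is_enum K ks"
    unfolding ks_def by (rule some_enum_is_enum[OF K(1)])
  have len: "length ks = N"
    using xs ks K(2) by (metis N_def distinct_card is_enum_def)
  have xsV: "xs ! i \<in> V" if "i < N" for i
    using xs that by (auto simp: is_enum_def N_def)
  have ksK: "ks ! i \<in> K" if "i < N" for i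
    using ks that len by (auto simp: is_enum_def)
  have ks_eq: "ks ! i = ks ! j \<longleftrightarrow> i = j" if "i < N" "j < N" for i j
    using ks that len by (auto simp: is_enum_def nth_eq_iff_index_eq)
  define A where "A = mat N N (\<lambda>(i, j). M (xs ! i) (xs ! j))"
  define W where "W = mat N N (\<lambda>(i, j). f (ks ! j) (xs ! i))"
  define W' where "W' = mat N N (\<lambda>(j, i). f (ks ! j) (xs ! i) / (\<Sum>v\<in>V. f (ks ! j) v * f (ks ! j) v))"
  define D where "D = mat N N (\<lambda>(i, j). if i = j then \<mu> (ks ! i) else 0)"
  have carr: "A \<in> carrier_mat N N" "W \<in> carrier_mat N N" "W' \<in> carrier_mat N N" "D \<in> carrier_mat N N"
    by (auto simp: A_def W_def W'_def D_def)
  have sumV: "(\<Sum>v\<in>V. h v) = (\<Sum>i\<in>{0..<N}. h (xs ! i))" for h :: "_ \<Rightarrow> real"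
    using sum_is_enum[OF xs, of h] by (simp add: N_def lessThan_atLeast0)
  have W'W: "W' * W = 1\<^sub>m N"
  proof (rule eq_matI)
    fix i j assume "i < dim_row (1\<^sub>m N)" "j < dim_col (1\<^sub>m N)"
    then have ij: "i < N" "j < N" by auto
    let ?n = "\<Sum>v\<in>V. f (ks ! i) v * f (ks ! i) v"
    have "(W' * W) $$ (i, j) = (\<Sum>l\<in>{0..<N}. f (ks ! i) (xs ! l) / ?n * f (ks ! j) (xs ! l))"
      using ij by (simp add: W'_def W_def scalar_prod_def)
    also have "\<dots> = (\<Sum>v\<in>V. f (ks ! i) v * f (ks ! j) v) / ?n"
      by (simp add: sumV[of "\<lambda>v. f (ks ! i) v * f (ks ! j) v"] sum_divide_distrib)
    also have "\<dots> = 1\<^sub>m N $$ (i, j)"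
      using ij orth[OF ksK ksK, of i j] orth[OF ksK ksK, of i i] by (auto simp: ks_eq)
    finally show "(W' * W) $$ (i, j) = 1\<^sub>m N $$ (i, j)" .
  qed (use carr in auto)
  have WW': "W * W' = 1\<^sub>m N"
    by (rule mat_mult_left_right_inverse[OF carr(3,2) W'W])
  have AW: "A * W = W * D"
  proof (rule eq_matI)
    fix i j assume "i < dim_row (W * D)" "j < dim_col (W * D)"
    then have ij: "i < N" "j < N" using carr by auto
    have "(A * W) $$ (i, j) = (\<Sum>v\<in>V. M (xs ! i) v * f (ks ! j) v)"
      using ij by (simp add: A_def W_def scalar_prod_def sumV)
    also have "\<dots> = f (ks ! j) (xs ! i) * \<mu> (ks ! j)"
      using eigen[OF ksK xsV] ij by simp
    also have "\<dots> = (W * D) $$ (i, j)"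
      using ij by (simp add: W_def D_def scalar_prod_def if_distrib[of "(*) _"] cong: if_cong)
    finally show "(A * W) $$ (i, j) = (W * D) $$ (i, j)" .
  qed (use carr in auto)
  have "A = W * D * W'"
    unfolding AW[symmetric] using carr WW' by (simp add: assoc_mult_mat[of A N N W N W' N])
  then have "similar_mat_wit A D W W'"
    unfolding similar_mat_wit_def Let_def using carr WW' W'W by auto
  then have "similar_mat A D"
    unfolding similar_mat_def by blast
  then have "char_poly A = (\<Prod>a\<leftarrow>diag_mat D. [:- a, 1:])"
    using char_poly_upper_triangular[OF carr(4)]
    by (simp add: char_poly_similar upper_triangular_def D_def)
  also have "diag_mat D = map \<mu> ks"
    by (auto simp: diag_mat_def D_def len intro!: nth_equalityI)
  finally have "mat_eigenvalues A = mset (map \<mu> ks)"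
    by (simp only: mat_eigenvalues_def proots_prod_linear_factors)
  also have "\<dots> = image_mset \<mu> (mset_set K)"
    using ks by (simp add: is_enum_def flip: mset_set_set)
  finally show ?thesis
    by (simp add: A_def N_def)
qed

text \<open>Each summand acts on one coordinate only, so on a product of eigenvectors the
  eigenvalues add. Inner products of such products factor, and are nonzero exactly when both indices
  agree.\<close>

lemma orthogonal_eigenbasis_sum:
  assumes "orthogonal_eigenbasis V M K f \<mu>" and "orthogonal_eigenbasis V' M' K' f' \<mu>'"
  shows "orthogonal_eigenbasis (V \<times> V')
    (\<lambda>(u, u') (v, v'). (if u' = v' then M u v else 0) + (if u = v then M' u' v' else 0))
    (K \<times> K') (\<lambda>(k, k') (v, v'). f k v * f' k' v') (\<lambda>(k, k'). \<mu> k + \<mu>' k')"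
proof -
  have fin: "finite V" "finite V'"
    and eigen: "\<And>k u. k \<in> K \<Longrightarrow> u \<in> V \<Longrightarrow> (\<Sum>v\<in>V. M u v * f k v) = \<mu> k * f k u"
    and eigen': "\<And>k u. k \<in> K' \<Longrightarrow> u \<in> V' \<Longrightarrow> (\<Sum>v\<in>V'. M' u v * f' k v) = \<mu>' k * f' k u"
    using assms unfolding orthogonal_eigenbasis_def by auto
  have E: "(\<Sum>(v, v')\<in>V \<times> V'. ((if u' = v' then M u v else 0) + (if u = v then M' u' v' else 0)) *
      (f k v * f' k' v')) = (\<mu> k + \<mu>' k') * (f k u * f' k' u')"
    if "k \<in> K" "k' \<in> K'" "u \<in> V" "u' \<in> V'" for k k' u u'
  proof -
    have "(\<Sum>(v, v')\<in>V \<times> V'. ((if u' = v' then M u v else 0) + (if u = v then M' u' v' else 0)) *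
        (f k v * f' k' v')) =
      (\<Sum>v\<in>V. \<Sum>v'\<in>V'. if u' = v' then M u v * f k v * f' k' v' else 0) +
      (\<Sum>v\<in>V. \<Sum>v'\<in>V'. if u = v then M' u' v' * f' k' v' * f k v else 0)"
      unfolding sum.cartesian_product[symmetric] sum.distrib[symmetric]
      by (intro sum.cong refl) (auto simp: algebra_simps)
    also have "(\<Sum>v\<in>V. \<Sum>v'\<in>V'. if u' = v' then M u v * f k v * f' k' v' else 0) =
        (\<Sum>v\<in>V. M u v * f k v) * f' k' u'"
      using that fin by (simp add: sum_distrib_right)
    \<comment> \<open>Here the delta fixes the outer variable, so the sums are exchanged before it
      collapses.\<close>
    also have "(\<Sum>v\<in>V. \<Sum>v'\<in>V'. if u = v then M' u' v' * f' k' v' * f k v else 0) =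
        (\<Sum>v'\<in>V'. M' u' v' * f' k' v') * f k u"
      using that fin by (subst sum.swap) (simp add: sum_distrib_right)
    finally show ?thesis
      using that by (simp add: eigen eigen' algebra_simps)
  qed
  have "(\<Sum>(v, v')\<in>V \<times> V'. (f k v * f' k' v') * (f l v * f' l' v')) =
      (\<Sum>v\<in>V. f k v * f l v) * (\<Sum>v'\<in>V'. f' k' v' * f' l' v')" for k k' l l'
    unfolding sum_product sum.cartesian_product[symmetric]
    by (intro sum.cong refl) (simp add: algebra_simps)
  then show ?thesis
    using assms E unfolding orthogonal_eigenbasis_def
    by (auto simp: case_prod_unfold card_cartesian_product cong: if_cong)
qed

text \<open>Symmetry of \<open>M\<close> gives orthogonality for free: moving \<open>M\<close>
  across the inner product of \<open>f k\<close> and \<open>f l\<close> yields the same number with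
  factor \<open>\<mu> k\<close> and with factor \<open>\<mu> l\<close>, and these differ by
  injectivity.\<close>

lemma orthogonal_eigenbasisI:
  assumes fin: "finite V" "finite K" "card K = card V"
    and sym: "\<And>u v. u \<in> V \<Longrightarrow> v \<in> V \<Longrightarrow> M u v = M v u"
    and eigen: "\<And>k u. k \<in> K \<Longrightarrow> u \<in> V \<Longrightarrow> (\<Sum>v\<in>V. M u v * f k v) = \<mu> k * f k u"
    and inj: "inj_on \<mu> K"
    and nonzero: "\<And>k. k \<in> K \<Longrightarrow> \<exists>v\<in>V. f k v \<noteq> 0"
  shows "orthogonal_eigenbasis V M K f \<mu>"
proof -
  have "(\<Sum>v\<in>V. f k v * f l v) = 0 \<longleftrightarrow> k \<noteq> l" if kl: "k \<in> K" "l \<in> K" for k l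
  proof (cases "k = l")
    case True
    then show ?thesis
      using nonzero[OF kl(1)] fin(1) by (auto simp: sum_nonneg_eq_0_iff)
  next
    case False
    have "\<mu> k * (\<Sum>u\<in>V. f k u * f l u) = (\<Sum>u\<in>V. \<Sum>v\<in>V. M u v * f k v * f l u)"
      unfolding sum_distrib_left sum_distrib_right[symmetric]
      by (intro sum.cong refl) (simp add: eigen kl)
    also have "\<dots> = (\<Sum>v\<in>V. \<Sum>u\<in>V. M v u * f l u * f k v)"
      by (subst sum.swap) (intro sum.cong refl, simp add: sym)
    also have "\<dots> = \<mu> l * (\<Sum>u\<in>V. f k u * f l u)"
      unfolding sum_distrib_left sum_distrib_right[symmetric]
      by (intro sum.cong refl) (simp add: eigen kl)
    finally show ?thesis
      using False inj kl by (auto simp: inj_on_def)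
  qed
  then show ?thesis
    unfolding orthogonal_eigenbasis_def using fin eigen by blast
qed

section \<open>Balance and Cartesian products\<close>

text \<open>The signs are the coboundary of a function \<open>s\<close> with values 1 and -1;
  equivalently, switching by \<open>s\<close> makes every edge positive.\<close>

definition switching :: "'a sgraph \<Rightarrow> ('a \<Rightarrow> real) \<Rightarrow> bool" where
  "switching S s \<longleftrightarrow> (\<forall>v\<in>verts S. s v * s v = 1) \<and>
     (\<forall>u v. {u, v} \<in> edges S \<longrightarrow> sign S {u, v} = s u * s v)"

lemma prod_cyclic_shift:
  fixes h :: "nat \<Rightarrow> 'b::comm_monoid_mult"
  assumes "0 < n"
  shows "(\<Prod>i<n. h (Suc i mod n)) = (\<Prod>i<n. h i)"
proof -
  obtain k where n: "n = Suc k" using assms gr0_implies_Suc by blast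
  \<comment> \<open>Only the last index \<open>k\<close> wraps around, to 0; below it the modulus
    has no effect.\<close>
  have "(\<Prod>i<k. h (Suc i mod n)) = (\<Prod>i<k. h (Suc i))"
    by (rule prod.cong) (auto simp: n)
  then show ?thesis
    unfolding prod.lessThan_Suc_shift[of h k] n by (simp add: mult.commute)
qed

text \<open>Every vertex of a cycle lies on two of its edges, so its value of \<open>s\<close>
  enters the sign product twice and squares to 1.\<close>

lemma switching_balanced:
  assumes S: "signed_graph S" and s: "switching S s"
  shows "balanced S"
  unfolding balanced_def
proof (intro allI impI)
  fix c assume c: "is_cycle S c"
  let ?n = "length c"
  have n: "0 < ?n" using c by (auto simp: is_cycle_def)
  have e: "{c ! i, c ! (Suc i mod ?n)} \<in> edges S" if "i < ?n" for i
    using c that by (simp add: is_cycle_def)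
  have "(\<Prod>i<?n. sign S {c ! i, c ! (Suc i mod ?n)}) = (\<Prod>i<?n. s (c ! i) * s (c ! (Suc i mod ?n)))"
    by (rule prod.cong) (use s e in \<open>auto simp: switching_def\<close>)
  also have "\<dots> = (\<Prod>i<?n. s (c ! i) * s (c ! i))"
    by (simp add: prod.distrib prod_cyclic_shift[OF n, of "\<lambda>i. s (c ! i)"])
  also have "\<dots> = 1"
    by (rule prod.neutral) (use s signed_graph_edge(1)[OF S e] in \<open>auto simp: switching_def\<close>)
  finally show "(\<Prod>i<?n. sign S {c ! i, c ! (Suc i mod ?n)}) = 1" .
qed

section \<open>Switchings, edges and matrix entries of Cartesian products\<close>

lemma verts_cart_prod [simp]: "verts (cart_prod S T) = verts S \<times> verts T"
  by (simp add: cart_prod_def)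

text \<open>The defining comprehension ranges over all ways of writing an edge as a pair. Its
  condition is symmetric in the two ends, so it may be tested on any given pair.\<close>

lemma edge_cart_prod:
  "{(u, v), (u', v')} \<in> edges (cart_prod S T) \<longleftrightarrow>
    (v = v' \<and> v \<in> verts T \<and> {u, u'} \<in> edges S) \<or> (u = u' \<and> u \<in> verts S \<and> {v, v'} \<in> edges T)"
  unfolding cart_prod_def
  by (auto simp: doubleton_eq_iff insert_commute)

lemma signed_graph_no_loop: "signed_graph S \<Longrightarrow> {u} \<notin> edges S"
  using signed_graph_edge(3)[of S u u] by auto

text \<open>Along an edge one coordinate stays fixed; its factor squares to 1, and what remains is
  the sign in the other factor.\<close>

lemma switching_cart_prod:
  assumes S: "signed_graph S" and T: "signed_graph T" and s: "switching S s" and t: "switching T t"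
  shows "switching (cart_prod S T) (\<lambda>(u, v). s u * t v)"
proof -
  have "sign (cart_prod S T) {(u, v), (u', v')} = s u * t v * (s u' * t v')"
    if "{(u, v), (u', v')} \<in> edges (cart_prod S T)" for u v u' v'
  proof -
    from that[unfolded edge_cart_prod] show ?thesis
    proof (elim disjE conjE)
      assume a: "v = v'" "v \<in> verts T" "{u, u'} \<in> edges S"
      have "s u * t v * (s u' * t v) = s u * s u' * (t v * t v)" by simp
      then show ?thesis
        using s t a by (simp add: sign_cart_prod_fst switching_def)
    next
      assume a: "u = u'" "u \<in> verts S" "{v, v'} \<in> edges T"
      have "s u * t v * (s u * t v') = t v * t v' * (s u * s u)" by simp
      \<comment> \<open>The sign in a product is read off from the coordinate that moves, so the
        second coordinate has to change.\<close>
      moreover have "v \<noteq> v'" using signed_graph_edge(3)[OF T a(3)] .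
      ultimately show ?thesis
        using s t a by (simp add: sign_cart_prod_snd switching_def)
    qed
  qed
  moreover have "s u * t v * (s u * t v) = 1" if "u \<in> verts S" "v \<in> verts T" for u v
  proof -
    have "s u * t v * (s u * t v) = (s u * s u) * (t v * t v)" by simp
    also have "\<dots> = 1" using s t that by (simp add: switching_def)
    finally show ?thesis .
  qed
  ultimately show ?thesis
    by (auto simp: switching_def)
qed

text \<open>Entries indexed by vertices instead of positions, the form that
  \<open>orthogonal_eigenbasis\<close> takes.\<close>

definition adj :: "'a sgraph \<Rightarrow> 'a \<Rightarrow> 'a \<Rightarrow> real" where
  "adj S u v = (if {u, v} \<in> edges S then sign S {u, v} else 0)"

definition lap :: "'a sgraph \<Rightarrow> 'a \<Rightarrow> 'a \<Rightarrow> real" where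
  "lap S u v = (if u = v then real (vertex_degree S u) else 0) - adj S u v"

lemma adj_commute: "adj S u v = adj S v u"
  by (simp add: adj_def insert_commute)

lemma lap_commute: "lap S u v = lap S v u"
  by (simp add: lap_def adj_commute)

lemma adjacency_mat_adj:
  "adjacency_mat S xs = mat (length xs) (length xs) (\<lambda>(i, j). adj S (xs ! i) (xs ! j))"
  by (simp add: adjacency_mat_def adj_def)

text \<open>The degree matrix compares positions while \<open>lap\<close> compares vertices;
  distinctness of \<open>xs\<close> makes the two tests agree.\<close>

lemma laplacian_mat_lap:
  assumes "distinct xs"
  shows "laplacian_mat S xs = mat (length xs) (length xs) (\<lambda>(i, j). lap S (xs ! i) (xs ! j))"
  by (rule eq_matI)
    (use assms in \<open>auto simp: laplacian_mat_def degree_mat_def adjacency_mat_adj lap_def nth_eq_iff_index_eq\<close>)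

text \<open>There are no loops, so both summands vanish when both coordinates agree, and otherwise
  at most one condition holds: no edge is counted twice.\<close>

lemma adj_cart_prod:
  assumes "signed_graph S" "signed_graph T" "u \<in> verts S" "u' \<in> verts S" "v \<in> verts T" "v' \<in> verts T"
  shows "adj (cart_prod S T) (u, v) (u', v') =
    (if v = v' then adj S u u' else 0) + (if u = u' then adj T v v' else 0)"
  using assms signed_graph_no_loop[OF assms(1)] signed_graph_no_loop[OF assms(2)]
  by (auto simp: adj_def edge_cart_prod sign_cart_prod_fst sign_cart_prod_snd)

text \<open>Splits the edges into copies of the edges of either factor, a form in which they can be
  counted.\<close>

lemma edges_cart_prod:
  assumes S: "signed_graph S" and T: "signed_graph T"
  shows "edges (cart_prod S T) =
    (\<lambda>(e, v). e \<times> {v}) ` (edges S \<times> verts T) \<union> (\<lambda>(u, e). {u} \<times> e) ` (verts S \<times> edges T)"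
proof (intro Set.set_eqI iffI)
  fix e assume "e \<in> edges (cart_prod S T)"
  then obtain u v u' v' where e: "e = {(u, v), (u', v')}"
    and "(v = v' \<and> v \<in> verts T \<and> {u, u'} \<in> edges S) \<or> (u = u' \<and> u \<in> verts S \<and> {v, v'} \<in> edges T)"
    unfolding cart_prod_def sgraph.simps mem_Collect_eq by blast
  then show "e \<in> (\<lambda>(e, v). e \<times> {v}) ` (edges S \<times> verts T) \<union> (\<lambda>(u, e). {u} \<times> e) ` (verts S \<times> edges T)"
  proof (elim disjE conjE)
    assume "v = v'" "v \<in> verts T" "{u, u'} \<in> edges S"
    then have "e = (\<lambda>(e, v). e \<times> {v}) ({u, u'}, v)" "({u, u'}, v) \<in> edges S \<times> verts T"
      using e by auto
    then show ?thesis by blast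
  next
    assume "u = u'" "u \<in> verts S" "{v, v'} \<in> edges T"
    then have "e = (\<lambda>(u, e). {u} \<times> e) (u, {v, v'})" "(u, {v, v'}) \<in> verts S \<times> edges T"
      using e by auto
    then show ?thesis by blast
  qed
next
  fix e assume "e \<in> (\<lambda>(e, v). e \<times> {v}) ` (edges S \<times> verts T) \<union> (\<lambda>(u, e). {u} \<times> e) ` (verts S \<times> edges T)"
  then consider d v where "d \<in> edges S" "v \<in> verts T" "e = d \<times> {v}"
    | u d where "u \<in> verts S" "d \<in> edges T" "e = {u} \<times> d"
    by auto
  then show "e \<in> edges (cart_prod S T)"
  proof cases
    case 1
    then obtain a b where "d = {a, b}" using S unfolding signed_graph_def by blast
    then have "e = {(a, v), (b, v)}" using 1 by auto
    then show ?thesis using 1 \<open>d = {a, b}\<close> by (simp add: edge_cart_prod)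
  next
    case 2
    then obtain a b where "d = {a, b}" using T unfolding signed_graph_def by blast
    then have "e = {(u, a), (u, b)}" using 2 by auto
    then show ?thesis using 2 \<open>d = {a, b}\<close> by (simp add: edge_cart_prod)
  qed
qed

lemma card_edge: "signed_graph S \<Longrightarrow> e \<in> edges S \<Longrightarrow> card e = 2"
  unfolding signed_graph_def card_2_iff by blast

lemma finite_edges: "signed_graph S \<Longrightarrow> finite (edges S)"
  unfolding signed_graph_def
  by (rule finite_subset[of _ "Pow (verts S)"]) auto

text \<open>A nonempty product set determines its factors, which gives injectivity. A common element
  of the two families would force a two-element edge to equal a singleton. The lemma counts both all
  edges and the edges at one vertex.\<close>

lemma card_Times_singletons_Un:
  assumes fin: "finite E" "finite V" "finite U" "finite F"
    and card: "\<And>e. e \<in> E \<Longrightarrow> card e = 2" "\<And>e. e \<in> F \<Longrightarrow> card e = 2"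
  shows "card ((\<lambda>(e, v). e \<times> {v}) ` (E \<times> V) \<union> (\<lambda>(u, e). {u} \<times> e) ` (U \<times> F)) =
    card E * card V + card U * card F"
proof -
  have ne: "{} \<notin> E" "{} \<notin> F" using card(1)[of "{}"] card(2)[of "{}"] by auto
  have inj: "inj_on (\<lambda>(e, v). e \<times> {v}) (E \<times> V)" "inj_on (\<lambda>(u, e). {u} \<times> e) (U \<times> F)"
    using ne by (auto simp: inj_on_def times_eq_iff)
  have disj: "(\<lambda>(e, v). e \<times> {v}) ` (E \<times> V) \<inter> (\<lambda>(u, e). {u} \<times> e) ` (U \<times> F) = {}"
  proof -
    have "e \<times> {v} \<noteq> {u} \<times> d" if "e \<in> E" "d \<in> F" for e v u d
      using card(1)[OF that(1)] card(2)[OF that(2)] by (auto simp: times_eq_iff)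
    then show ?thesis by auto
  qed
  show ?thesis
    using fin by (simp add: card_Un_disjoint disj card_image inj card_cartesian_product)
qed

lemma card_edges_cart_prod:
  assumes "signed_graph S" "signed_graph T"
  shows "card (edges (cart_prod S T)) =
    card (edges S) * card (verts T) + card (verts S) * card (edges T)"
  unfolding edges_cart_prod[OF assms]
  by (rule card_Times_singletons_Un)
    (use assms in \<open>auto simp: card_edge finite_edges\<close>, auto simp: signed_graph_def)

lemma vertex_degree_cart_prod:
  assumes "signed_graph S" "signed_graph T" "u \<in> verts S" "v \<in> verts T"
  shows "vertex_degree (cart_prod S T) (u, v) = vertex_degree S u + vertex_degree T v"
proof -
  \<comment> \<open>The edges at \<open>(u, v)\<close> lie in the copy of the first factor at
    \<open>v\<close> or of the second at \<open>u\<close>, so the counting lemma applies with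
    singletons as vertex sets.\<close>
  have star: "{e \<in> edges (cart_prod S T). (u, v) \<in> e} =
      (\<lambda>(e, v). e \<times> {v}) ` ({e \<in> edges S. u \<in> e} \<times> {v}) \<union>
      (\<lambda>(u, e). {u} \<times> e) ` ({u} \<times> {e \<in> edges T. v \<in> e})"
    unfolding edges_cart_prod[OF assms(1,2)] using assms(3,4) by auto
  show ?thesis
    unfolding vertex_degree_def star
    by (subst card_Times_singletons_Un) (use assms in \<open>auto simp: card_edge finite_edges\<close>)
qed

text \<open>Degrees add in a product, so the diagonal splits in the same way as the adjacency
  entries.\<close>

lemma lap_cart_prod:
  assumes "signed_graph S" "signed_graph T" "u \<in> verts S" "u' \<in> verts S" "v \<in> verts T" "v' \<in> verts T"
  shows "lap (cart_prod S T) (u, v) (u', v') =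
    (if v = v' then lap S u u' else 0) + (if u = u' then lap T v v' else 0)"
  using assms by (auto simp: lap_def adj_cart_prod vertex_degree_cart_prod)

section \<open>Spectra and Kronecker form of product matrices\<close>

lemma mat_eigenvalues_cart_prod:
  assumes S: "orthogonal_eigenbasis (verts S) M K f \<mu>" and T: "orthogonal_eigenbasis (verts T) M' K' f' \<mu>'"
    and xs: "is_enum (verts (cart_prod S T)) xs"
    and N: "\<And>u v u' v'. u \<in> verts S \<Longrightarrow> u' \<in> verts S \<Longrightarrow> v \<in> verts T \<Longrightarrow> v' \<in> verts T \<Longrightarrow>
      N (u, v) (u', v') = (if v = v' then M u u' else 0) + (if u = u' then M' v v' else 0)"
  shows "mat_eigenvalues (mat (length xs) (length xs) (\<lambda>(i, j). N (xs ! i) (xs ! j))) =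
    image_mset (\<lambda>(k, k'). \<mu> k + \<mu>' k') (mset_set (K \<times> K'))"
proof -
  have xsV: "xs ! i \<in> verts S \<times> verts T" if "i < length xs" for i
    using xs nth_mem[OF that] by (simp add: is_enum_def)
  have "mat (length xs) (length xs) (\<lambda>(i, j). N (xs ! i) (xs ! j)) =
     mat (length xs) (length xs) (\<lambda>(i, j). (\<lambda>(u, u') (v, v').
       (if u' = v' then M u v else 0) + (if u = v then M' u' v' else 0)) (xs ! i) (xs ! j))"
  proof (rule cong_mat[OF refl refl])
    fix i j assume ij: "i < length xs" "j < length xs"
    obtain u v u' v' where "xs ! i = (u, v)" "xs ! j = (u', v')" by fastforce
    with xsV[OF ij(1)] xsV[OF ij(2)] show "(case (i, j) of (i, j) \<Rightarrow> N (xs ! i) (xs ! j)) =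
        (case (i, j) of (i, j) \<Rightarrow> (\<lambda>(u, u') (v, v').
       (if u' = v' then M u v else 0) + (if u = v then M' u' v' else 0)) (xs ! i) (xs ! j))"
      by (simp add: N)
  qed
  then show ?thesis
    using orthogonal_eigenbasis_mat_eigenvalues[OF orthogonal_eigenbasis_sum[OF S T]] xs by simp
qed

text \<open>In lexicographic order the pair \<open>(vs ! a, ws ! b)\<close> stands at position
  \<open>a * length ws + b\<close>, so quotient and remainder by \<open>length ws\<close> recover
  \<open>a\<close> and \<open>b\<close>, just as in \<open>kronecker\<close>.\<close>

lemma kronecker_sum_product:
  assumes V: "distinct vs" and W: "distinct ws"
    and N: "\<And>u v u' v'. u \<in> set vs \<Longrightarrow> u' \<in> set vs \<Longrightarrow> v \<in> set ws \<Longrightarrow> v' \<in> set ws \<Longrightarrow>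
      N (u, v) (u', v') = (if v = v' then M u u' else 0) + (if u = u' then M' v v' else (0::real))"
  shows "mat (length vs * length ws) (length vs * length ws)
      (\<lambda>(i, j). N (List.product vs ws ! i) (List.product vs ws ! j)) =
    kronecker (mat (length vs) (length vs) (\<lambda>(i, j). M (vs ! i) (vs ! j))) (1\<^sub>m (length ws)) +
    kronecker (1\<^sub>m (length vs)) (mat (length ws) (length ws) (\<lambda>(i, j). M' (ws ! i) (ws ! j)))"
proof (rule eq_matI, goal_cases)
  case (1 i j)
  let ?n = "length ws"
  have ij: "i < length vs * ?n" "j < length vs * ?n" using 1 by (auto simp: kronecker_def)
  then have n: "0 < ?n" by (cases ws) auto
  define a b a' b' where ab: "a = i div ?n" "b = i mod ?n" "a' = j div ?n" "b' = j mod ?n"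
  have lt: "a < length vs" "b < ?n" "a' < length vs" "b' < ?n"
    using ij n by (auto simp: ab less_mult_imp_div_less)
  have "N (vs ! a, ws ! b) (vs ! a', ws ! b') =
      (if b = b' then M (vs ! a) (vs ! a') else 0) + (if a = a' then M' (ws ! b) (ws ! b') else 0)"
    by (subst N) (use lt V W in \<open>simp_all add: nth_eq_iff_index_eq\<close>)
  also have "\<dots> = M (vs ! a) (vs ! a') * 1\<^sub>m ?n $$ (b, b') + 1\<^sub>m (length vs) $$ (a, a') * M' (ws ! b) (ws ! b')"
    using lt by simp
  finally have "N (vs ! a, ws ! b) (vs ! a', ws ! b') = \<dots>" .
  moreover have "List.product vs ws ! i = (vs ! a, ws ! b)" "List.product vs ws ! j = (vs ! a', ws ! b')"
    using ij by (simp_all only: product_nth ab)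
  ultimately show ?case
    using ij lt by (simp only: index_mat index_add_mat kronecker_def dim_row_mat dim_col_mat index_one_mat
      prod.case ab[symmetric] mult_1_right mult_1)
qed (auto simp: kronecker_def)


section \<open>Signed paths\<close>

context
  fixes n r :: nat and vs :: "'a list" and S :: "'a sgraph"
  assumes path: "signed_path n r vs S"
begin

lemma path_signed_graph: "signed_graph S"
  and path_verts: "verts S = set vs"
  and path_distinct: "distinct vs"
  and path_length: "length vs = n"
  and path_edges: "edges S = {{vs ! i, vs ! Suc i} | i. Suc i < n}"
  using path by (auto simp: signed_path_def is_enum_def)

lemma path_nth_eq: "i < n \<Longrightarrow> j < n \<Longrightarrow> vs ! i = vs ! j \<longleftrightarrow> i = j"
  using path_distinct path_length by (simp add: nth_eq_iff_index_eq)

lemma path_vertexE: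
  assumes "v \<in> verts S"
  obtains i where "i < n" "v = vs ! i"
  using assms path_verts path_length by (auto simp: in_set_conv_nth)

lemma path_nth_verts: "i < n \<Longrightarrow> vs ! i \<in> verts S"
  using path_verts path_length by simp

lemma path_edge:
  assumes "i < n" "j < n"
  shows "{vs ! i, vs ! j} \<in> edges S \<longleftrightarrow> j = Suc i \<or> i = Suc j"
proof
  assume "{vs ! i, vs ! j} \<in> edges S"
  then obtain k where "Suc k < n" "{vs ! i, vs ! j} = {vs ! k, vs ! Suc k}"
    unfolding path_edges by blast
  then show "j = Suc i \<or> i = Suc j"
    using assms by (auto simp: doubleton_eq_iff path_nth_eq)
next
  assume "j = Suc i \<or> i = Suc j"
  then show "{vs ! i, vs ! j} \<in> edges S"
    unfolding path_edges using assms by (auto simp: insert_commute)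
qed

text \<open>An edge is identified by the index of its earlier end; edges and degrees are counted
  through this index.\<close>

lemma path_edge_inj: "inj_on (\<lambda>k. {vs ! k, vs ! Suc k}) {k. Suc k < n}"
  by (rule inj_onI) (auto simp: doubleton_eq_iff path_nth_eq)

lemma path_card_edges: "card (edges S) = n - 1"
proof -
  have "edges S = (\<lambda>k. {vs ! k, vs ! Suc k}) ` {k. Suc k < n}"
    unfolding path_edges by auto
  moreover have "{k. Suc k < n} = {..<n - 1}" by auto
  ultimately show ?thesis
    using card_image[OF path_edge_inj] by simp
qed

lemma path_vertex_degree:
  assumes "i < n"
  shows "vertex_degree S (vs ! i) = (if Suc i < n then 1 else 0) + (if 0 < i then 1 else 0)"
proof -
  \<comment> \<open>Indices of the earlier ends of the edges at \<open>vs ! i\<close>: the edge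
    leading on starts at \<open>i\<close>, the edge leading back at \<open>i - 1\<close>.\<close>
  let ?I = "(if Suc i < n then {i} else {}) \<union> (if 0 < i then {i - 1} else {})"
  have sub: "?I \<subseteq> {k. Suc k < n}" using assms by auto
  have "{e \<in> edges S. vs ! i \<in> e} =
      (\<lambda>k. {vs ! k, vs ! Suc k}) ` {k. Suc k < n \<and> vs ! i \<in> {vs ! k, vs ! Suc k}}"
    unfolding path_edges by blast
  also have "{k. Suc k < n \<and> vs ! i \<in> {vs ! k, vs ! Suc k}} = {k. Suc k < n \<and> (i = k \<or> i = Suc k)}"
    using assms by (intro Collect_cong conj_cong refl) (simp add: path_nth_eq)
  also have "\<dots> = ?I" using assms by (cases i) auto
  finally have "vertex_degree S (vs ! i) = card ?I"
    unfolding vertex_degree_def using card_image[OF inj_on_subset[OF path_edge_inj sub]] by simp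
  then show ?thesis by (cases i) simp_all
qed

lemma sum_adj_path:
  assumes i: "i < n"
  shows "(\<Sum>v\<in>verts S. adj S (vs ! i) v * h v) =
    (if Suc i < n then sign S {vs ! i, vs ! Suc i} * h (vs ! Suc i) else 0) +
    (if 0 < i then sign S {vs ! i, vs ! (i - 1)} * h (vs ! (i - 1)) else 0)"
proof -
  let ?t = "\<lambda>j. sign S {vs ! i, vs ! j} * h (vs ! j)"
  have "is_enum (verts S) vs" using path by (simp add: signed_path_def)
  then have "(\<Sum>v\<in>verts S. adj S (vs ! i) v * h v) = (\<Sum>j<n. adj S (vs ! i) (vs ! j) * h (vs ! j))"
    by (simp only: sum_is_enum path_length)
  also have "\<dots> = (\<Sum>j<n. (if Suc i = j then ?t j else 0) + (if i = Suc j then ?t j else 0))"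
    by (rule sum.cong) (use i in \<open>auto simp: adj_def path_edge\<close>)
  also have "\<dots> = (\<Sum>j<n. if Suc i = j then ?t j else 0) + (\<Sum>j<n. if i = Suc j then ?t j else 0)"
    by (rule sum.distrib)
  also have "(\<Sum>j<n. if i = Suc j then ?t j else 0) = (if 0 < i then ?t (i - 1) else 0)"
    using i by (cases i) simp_all
  finally show ?thesis by simp
qed

section \<open>Switching a signed path to the unsigned path\<close>

definition path_pos :: "'a \<Rightarrow> nat" where
  "path_pos v = inv_into {..<n} (nth vs) v"

definition path_switch :: "'a \<Rightarrow> real" where
  "path_switch v = (\<Prod>k<path_pos v. sign S {vs ! k, vs ! Suc k})"

lemma path_pos_nth: "i < n \<Longrightarrow> path_pos (vs ! i) = i"
  unfolding path_pos_def by (rule inv_into_f_f) (auto simp: inj_on_def path_nth_eq)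

lemma path_sign_sq: "Suc i < n \<Longrightarrow> sign S {vs ! i, vs ! Suc i} * sign S {vs ! i, vs ! Suc i} = 1"
  using signed_graph_edge(4)[OF path_signed_graph, of "vs ! i" "vs ! Suc i"] by (auto simp: path_edge)

lemma path_switch_sq: "i < n \<Longrightarrow> path_switch (vs ! i) * path_switch (vs ! i) = 1"
  by (simp add: path_switch_def path_pos_nth path_sign_sq flip: prod.distrib)

text \<open>One step along the path multiplies the running product by the sign of the edge;
  multiplying by the earlier value, whose square is 1, isolates that sign.\<close>

lemma path_sign_switch:
  assumes "Suc i < n"
  shows "sign S {vs ! i, vs ! Suc i} = path_switch (vs ! i) * path_switch (vs ! Suc i)"
proof -
  have "path_switch (vs ! Suc i) = path_switch (vs ! i) * sign S {vs ! i, vs ! Suc i}"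
    using assms by (simp add: path_switch_def path_pos_nth)
  then show ?thesis
    using path_switch_sq[of i] assms by (simp flip: mult.assoc)
qed

lemma path_switching: "switching S path_switch"
proof -
  have "sign S {u, v} = path_switch u * path_switch v" if e: "{u, v} \<in> edges S" for u v
  proof -
    from e obtain k where k: "Suc k < n" "{u, v} = {vs ! k, vs ! Suc k}" unfolding path_edges by blast
    then have "path_switch u * path_switch v = path_switch (vs ! k) * path_switch (vs ! Suc k)"
      unfolding doubleton_eq_iff by (elim disjE conjE) simp_all
    then show ?thesis
      using k by (simp only: path_sign_switch)
  qed
  then show ?thesis
    unfolding switching_def by (auto elim!: path_vertexE simp: path_switch_sq)
qed

text \<open>The sign of an edge is the product of the switch values at its ends. The value at the
  neighbour therefore squares away, the one at \<open>vs ! i\<close> factors out, and the unsigned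
  path acts on the sequence \<open>x\<close>.\<close>

lemma sum_adj_path_switch:
  assumes i: "i < n"
  shows "(\<Sum>v\<in>verts S. adj S (vs ! i) v * (path_switch v * x (path_pos v))) =
    path_switch (vs ! i) * ((if Suc i < n then x (Suc i) else 0) + (if 0 < i then x (i - 1) else 0))"
proof -
  let ?s = "\<lambda>i. path_switch (vs ! i)"
  have up: "(if Suc i < n then sign S {vs ! i, vs ! Suc i} * (?s (Suc i) * x (path_pos (vs ! Suc i))) else 0) =
      ?s i * (if Suc i < n then x (Suc i) else 0)"
  proof (cases "Suc i < n")
    case True
    have "sign S {vs ! i, vs ! Suc i} * (?s (Suc i) * x (Suc i)) = ?s i * x (Suc i) * (?s (Suc i) * ?s (Suc i))"
      by (simp add: path_sign_switch[OF True])
    then show ?thesis using path_switch_sq[OF True] True by (simp add: path_pos_nth)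
  qed simp
  have down: "(if 0 < i then sign S {vs ! i, vs ! (i - 1)} * (?s (i - 1) * x (path_pos (vs ! (i - 1)))) else 0) =
      ?s i * (if 0 < i then x (i - 1) else 0)"
  proof (cases i)
    case (Suc k)
    then have k: "k < n" "Suc k < n" using i by auto
    have "sign S {vs ! Suc k, vs ! k} = ?s k * ?s (Suc k)"
      using path_sign_switch[OF k(2)] by (simp only: insert_commute)
    then have "sign S {vs ! Suc k, vs ! k} * (?s k * x k) = ?s (Suc k) * x k * (?s k * ?s k)"
      by simp
    then show ?thesis using path_switch_sq[OF k(1)] k Suc by (simp add: path_pos_nth)
  qed simp
  show ?thesis
    unfolding sum_adj_path[OF i] up down by (simp only: distrib_left)
qed

text \<open>The degree counts the neighbours present, so the diagonal term can be shared out among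
  them, leaving one difference per neighbour.\<close>

lemma sum_lap_path_switch:
  assumes i: "i < n"
  shows "(\<Sum>v\<in>verts S. lap S (vs ! i) v * (path_switch v * x (path_pos v))) =
    path_switch (vs ! i) *
      ((if Suc i < n then x i - x (Suc i) else 0) + (if 0 < i then x i - x (i - 1) else 0))"
proof -
  have "(\<Sum>v\<in>verts S. lap S (vs ! i) v * (path_switch v * x (path_pos v))) =
      (\<Sum>v\<in>verts S. if vs ! i = v then real (vertex_degree S v) * (path_switch v * x (path_pos v)) else 0) -
      (\<Sum>v\<in>verts S. adj S (vs ! i) v * (path_switch v * x (path_pos v)))"
    unfolding sum_subtractf[symmetric]
    by (intro sum.cong refl) (simp add: lap_def left_diff_distrib)
  also have "(\<Sum>v\<in>verts S. if vs ! i = v then real (vertex_degree S v) * (path_switch v * x (path_pos v)) else 0) =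
      real (vertex_degree S (vs ! i)) * (path_switch (vs ! i) * x i)"
    using i path_nth_verts by (simp add: path_verts path_pos_nth)
  also have "\<dots> - (\<Sum>v\<in>verts S. adj S (vs ! i) v * (path_switch v * x (path_pos v))) =
      path_switch (vs ! i) *
        ((if Suc i < n then x i - x (Suc i) else 0) + (if 0 < i then x i - x (i - 1) else 0))"
    unfolding sum_adj_path_switch[OF i] path_vertex_degree[OF i] by (simp add: algebra_simps)
  finally show ?thesis .
qed

lemma path_switch_nonzero: "i < n \<Longrightarrow> path_switch (vs ! i) \<noteq> 0"
  using path_switch_sq[of i] by auto

text \<open>Reduces the diagonalisation to sequences \<open>x k\<close> on positions. Checking
  position 0 suffices for nonvanishing, since switch values are nonzero.\<close>

lemma path_orthogonal_eigenbasisI: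
  assumes n: "0 < n" and sym: "\<And>u v. M u v = M v u"
    and eigen: "\<And>k i. k \<in> {1..n} \<Longrightarrow> i < n \<Longrightarrow>
      (\<Sum>v\<in>verts S. M (vs ! i) v * (path_switch v * x k (path_pos v))) = \<mu> k * (path_switch (vs ! i) * x k i)"
    and inj: "inj_on \<mu> {1..n}"
    and nonzero: "\<And>k. k \<in> {1..n} \<Longrightarrow> x k 0 \<noteq> 0"
  shows "orthogonal_eigenbasis (verts S) M {1..n} (\<lambda>k v. path_switch v * x k (path_pos v)) \<mu>"
proof (rule orthogonal_eigenbasisI)
  show "card {1..n} = card (verts S)"
    using path_verts path_distinct path_length by (simp add: distinct_card)
  show "(\<Sum>v\<in>verts S. M u v * (path_switch v * x k (path_pos v))) = \<mu> k * (path_switch u * x k (path_pos u))"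
    if "k \<in> {1..n}" "u \<in> verts S" for k u
    using that(2) by (rule path_vertexE) (simp add: eigen[OF that(1)] path_pos_nth)
  show "\<exists>v\<in>verts S. path_switch v * x k (path_pos v) \<noteq> 0" if "k \<in> {1..n}" for k
    using n nonzero[OF that] path_switch_nonzero[OF n] path_nth_verts[OF n]
    by (intro bexI[of _ "vs ! 0"]) (auto simp: path_pos_nth)
qed (use path_verts sym inj in auto)

section \<open>Explicit eigenvectors of a path\<close>

lemma path_adj_eigenbasis:
  assumes n: "0 < n"
  shows "\<exists>f. orthogonal_eigenbasis (verts S) (adj S) {1..n} f (\<lambda>k. 2 * cos (pi * real k / real (n + 1)))"
proof -
  define \<theta> where "\<theta> k = pi * real k / real (n + 1)" for k
  \<comment> \<open>Positions start at 0, so the shift by 1 places the zeros at positions -1 and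
    \<open>n\<close>.\<close>
  define x where "x k i = sin (\<theta> k * (real i + 1))" for k i
  have range: "0 < \<theta> k" "\<theta> k < pi" if "k \<in> {1..n}" for k
    using that mult_strict_left_mono[of "real k" "real (n + 1)" pi]
    by (simp_all add: \<theta>_def pos_divide_less_eq del: of_nat_add of_nat_Suc)
  have "orthogonal_eigenbasis (verts S) (adj S) {1..n} (\<lambda>k v. path_switch v * x k (path_pos v))
      (\<lambda>k. 2 * cos (\<theta> k))"
  proof (rule path_orthogonal_eigenbasisI[OF n])
    fix k i assume k: "k \<in> {1..n}" and i: "i < n"
    \<comment> \<open>Past the last vertex the angle is \<open>\<theta> k * (n + 1)\<close>, a
      multiple of \<open>pi\<close>, so the absent neighbour may be given its sine value 0.\<close>
    have up: "(if Suc i < n then x k (Suc i) else 0) = sin (\<theta> k * (real i + 1) + \<theta> k)"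
    proof (cases "Suc i < n")
      case False
      then have "n = Suc i" using i by simp
      then have "\<theta> k * (real i + 1) + \<theta> k = \<theta> k * real (n + 1)"
        by (simp add: algebra_simps)
      also have "\<dots> = real k * pi"
        by (simp add: \<theta>_def del: of_nat_add of_nat_Suc)
      finally have "\<theta> k * (real i + 1) + \<theta> k = real k * pi" .
      then show ?thesis using False by simp
    qed (simp add: x_def algebra_simps)
    have down: "(if 0 < i then x k (i - 1) else 0) = sin (\<theta> k * (real i + 1) - \<theta> k)"
      by (auto simp: x_def algebra_simps)
    show "(\<Sum>v\<in>verts S. adj S (vs ! i) v * (path_switch v * x k (path_pos v))) =
        2 * cos (\<theta> k) * (path_switch (vs ! i) * x k i)"
      unfolding sum_adj_path_switch[OF i] up down by (simp add: x_def sin_add sin_diff)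
  next
    show "inj_on (\<lambda>k. 2 * cos (\<theta> k)) {1..n}"
    proof (rule inj_onI)
      fix k l assume kl: "k \<in> {1..n}" "l \<in> {1..n}" "2 * cos (\<theta> k) = 2 * cos (\<theta> l)"
      \<comment> \<open>Both angles lie in the interval from 0 to \<open>pi\<close>, where cosine is
        injective.\<close>
      then have "\<theta> k = \<theta> l"
        using range[OF kl(1)] range[OF kl(2)] by - (rule cos_inj_pi, simp_all)
      then show "k = l" by (simp add: \<theta>_def)
    qed
  next
    fix k assume "k \<in> {1..n}"
    then have "0 < sin (\<theta> k)"
      by (intro sin_gt_zero range)
    then show "x k 0 \<noteq> 0"
      by (simp add: x_def)
  qed (rule adj_commute)
  then show ?thesis unfolding \<theta>_def by blast
qed

lemma path_lap_eigenbasis: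
  assumes n: "0 < n"
  shows "\<exists>f. orthogonal_eigenbasis (verts S) (lap S) {1..n} f (\<lambda>k. 2 + 2 * cos (pi * real k / real n))"
proof -
  \<comment> \<open>The reflection at \<open>pi\<close> turns the natural eigenvalue
    \<open>2 - 2 * cos (\<theta> k)\<close> into the stated form with a plus sign;
    \<open>k = n\<close> gives angle 0, the constant sequence and eigenvalue 0.\<close>
  define \<theta> where "\<theta> k = pi - pi * real k / real n" for k
  define x where "x k i = cos (\<theta> k * (real i + 1 / 2))" for k i
  have range: "0 \<le> \<theta> k" "\<theta> k < pi" if "k \<in> {1..n}" for k
    using that by (auto simp: \<theta>_def field_simps)
  have "orthogonal_eigenbasis (verts S) (lap S) {1..n} (\<lambda>k v. path_switch v * x k (path_pos v))
      (\<lambda>k. 2 - 2 * cos (\<theta> k))"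
  proof (rule path_orthogonal_eigenbasisI[OF n])
    fix k i assume k: "k \<in> {1..n}" and i: "i < n"
    \<comment> \<open>At the last vertex the angles are \<open>\<theta> k * n\<close> minus and plus
      \<open>\<theta> k / 2\<close>. Their cosines agree since \<open>\<theta> k * n\<close> is a
      multiple of \<open>pi\<close>, so the absent difference is 0.\<close>
    have up: "(if Suc i < n then x k i - x k (Suc i) else 0) = x k i - cos (\<theta> k * (real i + 1 / 2) + \<theta> k)"
    proof (cases "Suc i < n")
      case False
      then have i_n: "n = Suc i" using i by simp
      have "\<theta> k * real n = real (n - k) * pi"
        using k n by (simp add: \<theta>_def field_simps)
      then have z: "sin (\<theta> k * real n) = 0" by simp
      have "x k i = cos (\<theta> k * real n - \<theta> k / 2)"
        by (simp add: x_def i_n algebra_simps)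
      moreover have "\<theta> k * (real i + 1 / 2) + \<theta> k = \<theta> k * real n + \<theta> k / 2"
        by (simp add: i_n algebra_simps)
      ultimately show ?thesis using False z by (simp add: cos_add cos_diff)
    qed (simp add: x_def algebra_simps)
    \<comment> \<open>At position 0 the two angles are \<open>\<theta> k / 2\<close> and its
      negative, and cosine is even.\<close>
    have down: "(if 0 < i then x k i - x k (i - 1) else 0) = x k i - cos (\<theta> k * (real i + 1 / 2) - \<theta> k)"
    proof (cases i)
      case 0
      have "\<theta> k * (1 / 2) - \<theta> k = - (\<theta> k * (1 / 2))" by simp
      then show ?thesis using 0 by (simp only: x_def) simp
    qed (simp add: x_def algebra_simps)
    show "(\<Sum>v\<in>verts S. lap S (vs ! i) v * (path_switch v * x k (path_pos v))) =
        (2 - 2 * cos (\<theta> k)) * (path_switch (vs ! i) * x k i)"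
      unfolding sum_lap_path_switch[OF i] up down cos_add cos_diff x_def[symmetric]
      by (simp add: algebra_simps)
  next
    show "inj_on (\<lambda>k. 2 - 2 * cos (\<theta> k)) {1..n}"
    proof (rule inj_onI)
      fix k l assume kl: "k \<in> {1..n}" "l \<in> {1..n}" "2 - 2 * cos (\<theta> k) = 2 - 2 * cos (\<theta> l)"
      then have "\<theta> k = \<theta> l"
        using range[OF kl(1)] range[OF kl(2)] by - (rule cos_inj_pi, simp_all)
      then show "k = l" using n by (simp add: \<theta>_def)
    qed
  next
    fix k assume "k \<in> {1..n}"
    \<comment> \<open>The value is \<open>cos (\<theta> k / 2)\<close>, positive because the half
      angle stays below \<open>pi / 2\<close>.\<close>
    then show "x k 0 \<noteq> 0"
      using cos_gt_zero_pi[of "\<theta> k / 2"] range[of k] by (auto simp: x_def)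
  qed (rule lap_commute)
  moreover have "2 - 2 * cos (\<theta> k) = 2 + 2 * cos (pi * real k / real n)" for k
    by (simp add: \<theta>_def)
  ultimately show ?thesis by (simp only:) blast
qed

text \<open>Inner vertices have degree 2 and each end lacks one neighbour, which the
  \<open>J_mat\<close> terms correct. For \<open>n = 1\<close> both corrections fall on the same
  entry and give degree 0.\<close>

lemma path_laplacian_mat:
  assumes n: "0 < n"
  shows "laplacian_mat S vs = 2 \<cdot>\<^sub>m 1\<^sub>m n - (adjacency_mat S vs + J_mat n 1 1 + J_mat n n n)"
proof (rule eq_matI)
  fix i j assume "i < dim_row (2 \<cdot>\<^sub>m 1\<^sub>m n - (adjacency_mat S vs + J_mat n 1 1 + J_mat n n n))"
    "j < dim_col (2 \<cdot>\<^sub>m 1\<^sub>m n - (adjacency_mat S vs + J_mat n 1 1 + J_mat n n n))"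
  then have ij: "i < n" "j < n" by (auto simp: J_mat_def)
  have "(if i = j then real (vertex_degree S (vs ! i)) else 0) =
      (if i = j then 2 else 0) - (if Suc i = 1 \<and> Suc j = 1 then 1 else 0) - (if Suc i = n \<and> Suc j = n then 1 else 0)"
    unfolding path_vertex_degree[OF ij(1)] using ij by simp
  then show "laplacian_mat S vs $$ (i, j) =
      (2 \<cdot>\<^sub>m 1\<^sub>m n - (adjacency_mat S vs + J_mat n 1 1 + J_mat n n n)) $$ (i, j)"
    using ij path_length by (simp add: laplacian_mat_def degree_mat_def adjacency_mat_def J_mat_def)
qed (use path_length in \<open>simp_all add: laplacian_mat_def degree_mat_def adjacency_mat_def J_mat_def\<close>)

end

section \<open>Algebra of Kronecker products\<close>

lemma kronecker_diff_left:
  assumes "A \<in> carrier_mat k l" "B \<in> carrier_mat k l"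
  shows "kronecker (A - B) C = kronecker A C - kronecker B C"
proof (rule eq_matI)
  fix i j assume "i < dim_row (kronecker A C - kronecker B C)" "j < dim_col (kronecker A C - kronecker B C)"
  then have ij: "i < k * dim_row C" "j < l * dim_col C"
    using assms by (auto simp: kronecker_def)
  then have "i div dim_row C < k" "j div dim_col C < l"
    by (auto simp: less_mult_imp_div_less)
  then show "kronecker (A - B) C $$ (i, j) = (kronecker A C - kronecker B C) $$ (i, j)"
    using ij assms by (simp add: kronecker_def left_diff_distrib)
qed (use assms in \<open>auto simp: kronecker_def\<close>)

lemma kronecker_diff_right:
  assumes "A \<in> carrier_mat k l" "B \<in> carrier_mat k l"
  shows "kronecker C (A - B) = kronecker C A - kronecker C B"
proof (rule eq_matI)
  fix i j assume "i < dim_row (kronecker C A - kronecker C B)" "j < dim_col (kronecker C A - kronecker C B)"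
  then have ij: "i < dim_row C * k" "j < dim_col C * l"
    using assms by (auto simp: kronecker_def)
  then have "i mod k < k" "j mod l < l"
    by (metis mod_less_divisor mult_0_right neq0_conv not_less_zero)+
  then show "kronecker C (A - B) $$ (i, j) = (kronecker C A - kronecker C B) $$ (i, j)"
    using ij assms by (simp add: kronecker_def right_diff_distrib)
qed (use assms in \<open>auto simp: kronecker_def\<close>)

lemma kronecker_smult_one:
  "kronecker (a \<cdot>\<^sub>m 1\<^sub>m m) (b \<cdot>\<^sub>m 1\<^sub>m n) = (a * b) \<cdot>\<^sub>m 1\<^sub>m (m * n)"
proof (rule eq_matI)
  fix i j assume "i < dim_row ((a * b) \<cdot>\<^sub>m 1\<^sub>m (m * n))" "j < dim_col ((a * b) \<cdot>\<^sub>m 1\<^sub>m (m * n))"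
  then have ij: "i < m * n" "j < m * n" by auto
  then have n: "0 < n" by (cases n) auto
  have lt: "i div n < m" "j div n < m" "i mod n < n" "j mod n < n"
    using ij n by (auto simp: less_mult_imp_div_less)
  \<comment> \<open>Quotient and remainder determine an index, so the diagonal tests of the two
    factors combine into one.\<close>
  have "i = j \<longleftrightarrow> i div n = j div n \<and> i mod n = j mod n"
    by (metis div_mult_mod_eq)
  then show "kronecker (a \<cdot>\<^sub>m 1\<^sub>m m) (b \<cdot>\<^sub>m 1\<^sub>m n) $$ (i, j) = ((a * b) \<cdot>\<^sub>m 1\<^sub>m (m * n)) $$ (i, j)"
    using ij lt by (auto simp: kronecker_def)
qed (auto simp: kronecker_def)

lemma count_image_mset_set_unique:
  assumes "finite A" "a \<in> A" "f a = y" "\<And>x. x \<in> A \<Longrightarrow> x \<noteq> a \<Longrightarrow> f x \<noteq> y"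
  shows "count (image_mset f (mset_set A)) y = 1"
proof -
  have "mset_set A = add_mset a (mset_set (A - {a}))"
    using assms(1,2) by (rule mset_set.remove)
  moreover have "count (image_mset f (mset_set (A - {a}))) y = 0"
    unfolding count_eq_zero_iff using assms(1,4) by fastforce
  ultimately show ?thesis using assms(3) by simp
qed

section \<open>The product of two signed paths\<close>

theorem corollary4p4:
  fixes P :: "'a sgraph" and Q :: "'b sgraph" and \<Sigma> :: "('a \<times> 'b) sgraph"
    and vs :: "'a list" and ws :: "'b list"
    and m n r1 r2 :: nat
    and lam lamL :: "nat \<Rightarrow> nat \<Rightarrow> real"
  assumes "1 \<le> m" and "1 \<le> n" and "r1 \<le> m - 1" and "r2 \<le> n - 1"
    and "signed_path m r1 vs P" and "signed_path n r2 ws Q"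
    and "\<Sigma> = cart_prod P Q"
    and "\<And>i j. lam i j = 2 * (cos (pi * real i / real (m + 1)) + cos (pi * real j / real (n + 1)))"
    and "\<And>i j. lamL i j = 2 * (2 + cos (pi * real i / real m) + cos (pi * real j / real n))"
  shows
    "balanced \<Sigma> \<and>
     adjacency_mat \<Sigma> (List.product vs ws) =
       kronecker (adjacency_mat P vs) (1\<^sub>m n) + kronecker (1\<^sub>m m) (adjacency_mat Q ws) \<and>
     laplacian_mat \<Sigma> (List.product vs ws) =
       4 \<cdot>\<^sub>m 1\<^sub>m (m * n)
       - kronecker (adjacency_mat P vs + J_mat m 1 1 + J_mat m m m) (1\<^sub>m n)
       - kronecker (1\<^sub>m m) (adjacency_mat Q ws + J_mat n 1 1 + J_mat n n n) \<and>
     eigenvalues \<Sigma> = image_mset (\<lambda>(i, j). lam i j) (mset_set ({1..m} \<times> {1..n})) \<and>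
     energy \<Sigma> = 2 * (\<Sum>i = 1..m. \<Sum>j = 1..n.
       \<bar>cos (pi * real i / real (m + 1)) + cos (pi * real j / real (n + 1))\<bar>) \<and>
     laplacian_eigenvalues \<Sigma> = image_mset (\<lambda>(i, j). lamL i j) (mset_set ({1..m} \<times> {1..n})) \<and>
     count (laplacian_eigenvalues \<Sigma>) 0 = 1 \<and>
     lamL m n = 0 \<and>
     (\<forall>i\<in>{1..m}. \<forall>j\<in>{1..n}. (i, j) \<noteq> (m, n) \<longrightarrow> 0 < lamL i j) \<and>
     laplacian_energy \<Sigma> = 2 * (\<Sum>i = 1..m. \<Sum>j = 1..n.
       \<bar>cos (pi * real i / real m) + cos (pi * real j / real n) + 1 / real m + 1 / real n\<bar>)"
proof -
  note m = \<open>1 \<le> m\<close> and n = \<open>1 \<le> n\<close>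
    and P = \<open>signed_path m r1 vs P\<close> and Q = \<open>signed_path n r2 ws Q\<close> and \<Sigma> = \<open>\<Sigma> = cart_prod P Q\<close>
    and lam = assms(8) and lamL = assms(9)
  have pos: "0 < m" "0 < n" using m n by auto
  note SP = path_signed_graph[OF P] and SQ = path_signed_graph[OF Q]
  note dP = path_distinct[OF P] and dQ = path_distinct[OF Q]
  note lP = path_length[OF P] and lQ = path_length[OF Q]
  let ?I = "{1..m} \<times> {1..n}"
  have card_verts: "card (verts P) = m" "card (verts Q) = n"
    using dP dQ lP lQ by (simp_all add: path_verts[OF P] path_verts[OF Q] distinct_card)

  have bal: "balanced \<Sigma>"
    unfolding \<Sigma>
    by (rule switching_balanced[OF signed_graph_cart_prod[OF SP SQ]
          switching_cart_prod[OF SP SQ path_switching[OF P] path_switching[OF Q]]])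

  have adjm: "adjacency_mat \<Sigma> (List.product vs ws) =
      kronecker (adjacency_mat P vs) (1\<^sub>m n) + kronecker (1\<^sub>m m) (adjacency_mat Q ws)"
    using kronecker_sum_product[OF dP dQ, of "adj \<Sigma>" "adj P" "adj Q"] adj_cart_prod[OF SP SQ]
    by (simp add: adjacency_mat_adj \<Sigma> path_verts[OF P] path_verts[OF Q] lP lQ)

  \<comment> \<open>The path Laplacians have the form \<open>2I - X\<close> and
    \<open>2I - Y\<close>; their Kronecker sum collects the two scalar parts into
    \<open>4I\<close>.\<close>
  have "laplacian_mat \<Sigma> (List.product vs ws) =
      kronecker (laplacian_mat P vs) (1\<^sub>m n) + kronecker (1\<^sub>m m) (laplacian_mat Q ws)"
    using kronecker_sum_product[OF dP dQ, of "lap \<Sigma>" "lap P" "lap Q"] lap_cart_prod[OF SP SQ]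
    by (simp add: laplacian_mat_lap dP dQ distinct_product \<Sigma> path_verts[OF P] path_verts[OF Q] lP lQ)
  moreover define X where "X = adjacency_mat P vs + J_mat m 1 1 + J_mat m m m"
  moreover define Y where "Y = adjacency_mat Q ws + J_mat n 1 1 + J_mat n n n"
  ultimately have "laplacian_mat \<Sigma> (List.product vs ws) =
      kronecker (2 \<cdot>\<^sub>m 1\<^sub>m m - X) (1\<^sub>m n) + kronecker (1\<^sub>m m) (2 \<cdot>\<^sub>m 1\<^sub>m n - Y)"
    by (simp only: path_laplacian_mat[OF P pos(1)] path_laplacian_mat[OF Q pos(2)])
  moreover have carr: "X \<in> carrier_mat m m" "Y \<in> carrier_mat n n"
    by (simp_all add: X_def Y_def J_mat_def)
  \<comment> \<open>Writing the identity as a scalar multiple of itself makes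
    \<open>kronecker_smult_one\<close> applicable to either factor.\<close>
  moreover have "1 \<cdot>\<^sub>m 1\<^sub>m k = (1\<^sub>m k :: real mat)" for k
    by (rule eq_matI) simp_all
  then have "kronecker (2 \<cdot>\<^sub>m 1\<^sub>m m) (1\<^sub>m n) = 2 \<cdot>\<^sub>m 1\<^sub>m (m * n)" "kronecker (1\<^sub>m m) (2 \<cdot>\<^sub>m 1\<^sub>m n) = 2 \<cdot>\<^sub>m 1\<^sub>m (m * n)"
    using kronecker_smult_one[of 2 m 1 n] kronecker_smult_one[of 1 m 2 n] by simp_all
  ultimately have "laplacian_mat \<Sigma> (List.product vs ws) =
      (2 \<cdot>\<^sub>m 1\<^sub>m (m * n) - kronecker X (1\<^sub>m n)) + (2 \<cdot>\<^sub>m 1\<^sub>m (m * n) - kronecker (1\<^sub>m m) Y)"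
    by (simp add: kronecker_diff_left[of _ m m] kronecker_diff_right[of _ n n])
  also have "\<dots> = 4 \<cdot>\<^sub>m 1\<^sub>m (m * n) - kronecker X (1\<^sub>m n) - kronecker (1\<^sub>m m) Y"
    by (rule eq_matI) (use carr in \<open>simp_all add: kronecker_def\<close>)
  finally have lapm: "laplacian_mat \<Sigma> (List.product vs ws) =
      4 \<cdot>\<^sub>m 1\<^sub>m (m * n) - kronecker X (1\<^sub>m n) - kronecker (1\<^sub>m m) Y" .

  have enum: "is_enum (verts (cart_prod P Q)) (some_enum (verts (cart_prod P Q)))"
    by (rule some_enum_is_enum) (simp add: path_verts[OF P] path_verts[OF Q])
  then have distinct: "distinct (some_enum (verts (cart_prod P Q)))"
    by (simp add: is_enum_def)

  obtain f g where
    "orthogonal_eigenbasis (verts P) (adj P) {1..m} f (\<lambda>k. 2 * cos (pi * real k / real (m + 1)))"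
    "orthogonal_eigenbasis (verts Q) (adj Q) {1..n} g (\<lambda>k. 2 * cos (pi * real k / real (n + 1)))"
    using path_adj_eigenbasis[OF P pos(1)] path_adj_eigenbasis[OF Q pos(2)] by blast
  from mat_eigenvalues_cart_prod[OF this enum adj_cart_prod[OF SP SQ]]
  have eig: "eigenvalues \<Sigma> = image_mset (\<lambda>(i, j). lam i j) (mset_set ?I)"
    by (simp add: eigenvalues_def \<Sigma> adjacency_mat_adj lam distrib_left)

  obtain f g where
    "orthogonal_eigenbasis (verts P) (lap P) {1..m} f (\<lambda>k. 2 + 2 * cos (pi * real k / real m))"
    "orthogonal_eigenbasis (verts Q) (lap Q) {1..n} g (\<lambda>k. 2 + 2 * cos (pi * real k / real n))"
    using path_lap_eigenbasis[OF P pos(1)] path_lap_eigenbasis[OF Q pos(2)] by blast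
  from mat_eigenvalues_cart_prod[OF this enum lap_cart_prod[OF SP SQ]]
  have leig: "laplacian_eigenvalues \<Sigma> = image_mset (\<lambda>(i, j). lamL i j) (mset_set ?I)"
    unfolding laplacian_eigenvalues_def \<Sigma> laplacian_mat_lap[OF distinct] by (simp add: lamL algebra_simps)

  have energy: "energy \<Sigma> = 2 * (\<Sum>i = 1..m. \<Sum>j = 1..n.
       \<bar>cos (pi * real i / real (m + 1)) + cos (pi * real j / real (n + 1))\<bar>)"
  proof -
    have "energy \<Sigma> = (\<Sum>(i, j)\<in>?I. \<bar>lam i j\<bar>)"
      by (simp only: energy_def eig sum_unfold_sum_mset image_mset.compositionality o_def case_prod_unfold)
    then show ?thesis
      by (simp only: sum.cartesian_product[symmetric] lam abs_mult abs_numeral sum_distrib_left)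
  qed

  \<comment> \<open>There are \<open>n\<close> copies of the first path and \<open>m\<close> of the
    second, with \<open>m - 1\<close> and \<open>n - 1\<close> edges each.\<close>
  have "mean_degree \<Sigma> = 2 * real ((m - 1) * n + m * (n - 1)) / real (m * n)"
    by (simp add: mean_degree_def \<Sigma> card_edges_cart_prod[OF SP SQ] path_card_edges[OF P] path_card_edges[OF Q]
        card_verts card_cartesian_product)
  also have "\<dots> = 4 - 2 / real m - 2 / real n"
  proof -
    have "real ((m - 1) * n + m * (n - 1)) = 2 * (real m * real n) - real n - real m"
      using pos by (cases m; cases n) (simp_all add: algebra_simps)
    then show ?thesis
      using pos by (simp only: of_nat_mult) (simp add: field_simps)
  qed
  finally have deg: "mean_degree \<Sigma> = 4 - 2 / real m - 2 / real n" .
  have lenergy: "laplacian_energy \<Sigma> = 2 * (\<Sum>i = 1..m. \<Sum>j = 1..n.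
       \<bar>cos (pi * real i / real m) + cos (pi * real j / real n) + 1 / real m + 1 / real n\<bar>)"
  proof -
    have "laplacian_energy \<Sigma> = (\<Sum>(i, j)\<in>?I. \<bar>lamL i j - mean_degree \<Sigma>\<bar>)"
      by (simp only: laplacian_energy_def leig sum_unfold_sum_mset image_mset.compositionality o_def case_prod_unfold)
    \<comment> \<open>The constants 4 cancel, and the remaining terms share the factor 2.\<close>
    moreover have "\<bar>lamL i j - mean_degree \<Sigma>\<bar> =
        2 * \<bar>cos (pi * real i / real m) + cos (pi * real j / real n) + 1 / real m + 1 / real n\<bar>" for i j
    proof -
      have "lamL i j - mean_degree \<Sigma> =
          2 * (cos (pi * real i / real m) + cos (pi * real j / real n) + 1 / real m + 1 / real n)"
        unfolding lamL deg by (simp add: algebra_simps)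
      then show ?thesis by (simp only: abs_mult abs_numeral)
    qed
    ultimately show ?thesis
      by (simp only: sum.cartesian_product[symmetric] sum_distrib_left)
  qed

  have zero: "lamL m n = 0"
    using pos by (simp add: lamL)
  \<comment> \<open>Cosine decreases strictly up to \<open>pi\<close>, so only the last index of a
    path attains -1.\<close>
  have cos_gt: "- 1 < cos (pi * real i / real k)" if "i < k" for i k :: nat
  proof -
    have "cos pi < cos (pi * real i / real k)"
      using that by (intro cos_monotone_0_pi) (auto simp: field_simps)
    then show ?thesis by simp
  qed
  have lamL_pos: "0 < lamL i j" if "i \<in> {1..m}" "j \<in> {1..n}" "(i, j) \<noteq> (m, n)" for i j
  proof -
    \<comment> \<open>One strict index makes one cosine exceed -1, while the other is at least
      -1.\<close>
    have "i < m \<or> j < n" using that by auto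
    moreover have "0 < 2 * (2 + a + b)" if "- 1 \<le> a" "- 1 \<le> b" "- 1 < a \<or> - 1 < b" for a b :: real
      using that by auto
    ultimately show ?thesis
      unfolding lamL using cos_gt cos_ge_minus_one by blast
  qed
  have count: "count (laplacian_eigenvalues \<Sigma>) 0 = 1"
    unfolding leig
  proof (rule count_image_mset_set_unique[of _ "(m, n)"])
    show "(case x of (i, j) \<Rightarrow> lamL i j) \<noteq> 0" if "x \<in> ?I" "x \<noteq> (m, n)" for x
      using that lamL_pos[of "fst x" "snd x"] by (cases x) simp
  qed (use zero m n in simp_all)

  show ?thesis
    by (intro conjI ballI impI bal adjm lapm[unfolded X_def Y_def] eig energy leig count zero lenergy)
      (rule lamL_pos)
qed

end
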